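(* Let $(\mathcal{X},\rho)$ be a separable metric space, let $c\in(0,1)$, and suppose that $\mathrm{LCJ}(\mathcal{X})\geq c$. Fix a point $x_0\in\mathcal{X}$ and let $K$ be the set of all functions $f\colon\mathcal{X}\to\mathbb{R}$ with $f(x_0)=0$ and $|f(x)-f(y)|\leq\rho(x,y)$ for all $x,y\in\mathcal{X}$, equipped with the topology of pointwise convergence. Then there exists a Borel probability measure $\nu$ on $K$ such that $$\int_K |f(x)-f(y)|\,d\nu(f)\geq c\,\rho(x,y)\qquad\text{for all } x,y\in\mathcal{X}.$$
   Context: Let $(\mathcal{X},\rho)$ be a metric space. For an arbitrary (not necessarily continuous) mapping $\gamma\colon[0,1]\to\mathcal{X}$, its total variation is $$\mathrm{V}_\gamma=\sup\sum_{i=0}^{N-1}\rho\big(\gamma(t_i),\gamma(t_{i+1})\big)\in[0,\infty],$$ where the supremum is over all finite collections $0\leq t_0\leq t_1\leq\dots\leq t_N\leq 1$. The total variation of a real-valued function on $[0,1]$ is defined in the same way, with the usual metric on $\mathbb{R}$. Denote by $\mathrm{BV}([0,1],\mathcal{X})$ the set of all mappings $\gamma\colon[0,1]\to\mathcal{X}$ with $\mathrm{V}_\gamma<\infty$. A function $f\colon\mathcal{X}\to\mathbb{R}$ is called $1$-Lipschitz if $|f(x)-f(y)|\leq\rho(x,y)$ for all $x,y\in\mathcal{X}$. The Lipschitz variation of $\gamma$ is $$\mathrm{LV}_\gamma=\sup\{\mathrm{V}_{f\circ\gamma} : f\colon\mathcal{X}\to\mathbb{R}\ \text{is } 1\text{-Lipschitz}\}.$$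 The constant $\mathrm{LCJ}(\mathcal{X})$ is defined by $$\mathrm{LCJ}(\mathcal{X})=\inf\Big\{\frac{\mathrm{LV}_\gamma}{\mathrm{V}_\gamma} : \gamma\in\mathrm{BV}([0,1],\mathcal{X}),\ \mathrm{V}_\gamma>0\Big\},$$ with the usual convention that the infimum of the empty set is $+\infty$ (relevant only if $\mathcal{X}$ has at most one point). *)

theory Defs
  imports "HOL-Probability.Probability"
begin

(* A mapping on [0,1] is represented by a total function on the reals; only its values on [0,1]
   enter the definitions below. A finite collection t 0 \<le> ... \<le> t N in [0,1] is given by N and t. *)
definition total_variation :: "(real \<Rightarrow> 'a::metric_space) \<Rightarrow> ennreal" where
  "total_variation \<gamma> =
     (SUP (N, t) \<in> {(N :: nat, t :: nat \<Rightarrow> real). 0 \<le> t 0 \<and> (\<forall>i<N. t i \<le> t (Suc i)) \<and> t N \<le> 1}.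
        \<Sum>i<N. ennreal (dist (\<gamma> (t i)) (\<gamma> (t (Suc i)))))"

definition BV :: "(real \<Rightarrow> 'a::metric_space) set" where
  "BV = {\<gamma>. total_variation \<gamma> < \<infinity>}"

definition lipschitz_variation :: "(real \<Rightarrow> 'a::metric_space) \<Rightarrow> ennreal" where
  "lipschitz_variation \<gamma> =
     (SUP f \<in> {f :: 'a \<Rightarrow> real. 1-lipschitz_on UNIV f}. total_variation (f \<circ> \<gamma>))"

(* The infimum is taken in ennreal, so it is \<infinity> if no curve qualifies. *)
definition LCJ :: "'a::metric_space itself \<Rightarrow> ennreal" where
  "LCJ _ = (INF \<gamma> \<in> {\<gamma> \<in> (BV :: (real \<Rightarrow> 'a) set). total_variation \<gamma> > 0}.
              lipschitz_variation \<gamma> / total_variation \<gamma>)"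

definition pointed_lipschitz :: "'a::metric_space \<Rightarrow> ('a \<Rightarrow> real) set" where
  "pointed_lipschitz x0 = {f. f x0 = 0 \<and> 1-lipschitz_on UNIV f}"

(* The library topology on 'a \<Rightarrow> real is the product topology, i.e. that of pointwise convergence.
   The trace on K of its Borel sigma-algebra is the Borel sigma-algebra of the subspace K. *)
definition borel_probability_on :: "('a \<Rightarrow> real) set \<Rightarrow> ('a \<Rightarrow> real) measure \<Rightarrow> bool" where
  "borel_probability_on K \<nu> \<longleftrightarrow> prob_space \<nu> \<and> sets \<nu> = sets (restrict_space borel K)"

end

theory Submission
  imports Defs
begin

text \<open>
  A step curve that runs back and forth many times between the points of each of finitely many pairs
  shows that for all weights \<open>w i \<ge> 0\<close> some 1-Lipschitz \<open>f\<close> nearly satisfies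
  \<open>\<Sum>i. w i * \<bar>f (x i) - f (y i)\<bar> \<ge> c * (\<Sum>i. w i * dist (x i) (y i))\<close>. Blackwell's approachability
  argument turns this into one finitely supported probability measure that nearly works for each of
  the pairs. For the limit over the pairs from a countable dense set, functions in \<open>K\<close> are encoded by
  points of the unit interval through a space-filling curve, so that Helly's selection theorem on the
  real line applies; the limit measure is pushed forward to \<open>K\<close> by McShane's extension.
\<close>

section \<open>Curves through finitely many points\<close>

text \<open>The value is \<open>z k\<close> on [k/M, (k+1)/M), and \<open>z M\<close> is reached
  only at 1. Curves in \<open>BV\<close> may jump, so every finite sequence of points gives a
  curve.\<close>

definition step_curve :: "(nat \<Rightarrow> 'a) \<Rightarrow> nat \<Rightarrow> real \<Rightarrow> 'a" where
  "step_curve z M t = z (nat \<lfloor>real M * t\<rfloor>)"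

lemma dist_le_sum_dist:
  fixes z :: "nat \<Rightarrow> 'a::metric_space"
  assumes "a \<le> b"
  shows "dist (z a) (z b) \<le> (\<Sum>k=a..<b. dist (z k) (z (Suc k)))"
  using assms
proof (induction b rule: dec_induct)
  case (step n)
  then show ?case
    using dist_triangle[of "z a" "z (Suc n)" "z n"] by simp
qed simp

text \<open>A partition visits indices \<open>j i\<close> that increase within 0..M. By the triangle
  inequality each of its jumps costs at most the consecutive blocks of \<open>z\<close> between two
  such indices, and these stretches do not overlap.\<close>

lemma total_variation_step_curve_le:
  fixes z :: "nat \<Rightarrow> 'a::metric_space"
  shows "total_variation (step_curve z M) \<le> ennreal (\<Sum>k<M. dist (z k) (z (Suc k)))"
  unfolding total_variation_def
proof (rule SUP_least, clarify)
  fix N :: nat and t :: "nat \<Rightarrow> real"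
  assume t: "0 \<le> t 0" "\<forall>i<N. t i \<le> t (Suc i)" "t N \<le> 1"
  define j where "j i = nat \<lfloor>real M * t i\<rfloor>" for i
  have mono: "j i \<le> j (Suc i)" if "i < N" for i
    using t(2) that unfolding j_def by (intro nat_mono floor_mono mult_left_mono) auto
  have j0: "j 0 \<le> j n" if "n \<le> N" for n
    using that
  proof (induction n)
    case (Suc n)
    then show ?case using mono[of n] by simp
  qed simp
  have "real M * t N \<le> real M"
    using t(3) by (simp add: mult_left_le)
  then have jN: "j N \<le> M"
    unfolding j_def by linarith
  have "(\<Sum>i<n. dist (z (j i)) (z (j (Suc i)))) \<le> (\<Sum>k=j 0..<j n. dist (z k) (z (Suc k)))"
    if "n \<le> N" for n
    using that
  proof (induction n)
    case (Suc n)
    have "(\<Sum>k=j 0..<j (Suc n). dist (z k) (z (Suc k)))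
      = (\<Sum>k=j 0..<j n. dist (z k) (z (Suc k))) + (\<Sum>k=j n..<j (Suc n). dist (z k) (z (Suc k)))"
      using Suc.prems mono[of n] j0[of n] by (simp add: sum.atLeastLessThan_concat)
    then show ?case
      using Suc dist_le_sum_dist[OF mono[of n], of z] by simp
  qed simp
  then have "(\<Sum>i<N. dist (z (j i)) (z (j (Suc i)))) \<le> (\<Sum>k=j 0..<j N. dist (z k) (z (Suc k)))"
    by simp
  also have "\<dots> \<le> (\<Sum>k<M. dist (z k) (z (Suc k)))"
    using jN by (intro sum_mono2) auto
  finally show "(\<Sum>i<N. ennreal (dist (step_curve z M (t i)) (step_curve z M (t (Suc i)))))
      \<le> ennreal (\<Sum>k<M. dist (z k) (z (Suc k)))"
    by (simp add: step_curve_def j_def sum_ennreal ennreal_leI)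
qed

lemma total_variation_step_curve_ge:
  fixes z :: "nat \<Rightarrow> 'a::metric_space"
  assumes "0 < M"
  shows "ennreal (\<Sum>k<M. dist (z k) (z (Suc k))) \<le> total_variation (step_curve z M)"
proof -
  have "step_curve z M (real i / real M) = z i" for i
    using assms by (simp add: step_curve_def)
  then have "ennreal (\<Sum>k<M. dist (z k) (z (Suc k))) = (\<Sum>i<M. ennreal (dist
      (step_curve z M (real i / real M)) (step_curve z M (real (Suc i) / real M))))"
    by (simp only: sum_ennreal zero_le_dist)
  also have "\<dots> \<le> total_variation (step_curve z M)"
    unfolding total_variation_def using assms
    by (intro SUP_upper2[of "(M, \<lambda>i. real i / real M)"]) (auto simp: divide_right_mono)
  finally show ?thesis .
qed

lemma comp_step_curve: "f \<circ> step_curve z M = step_curve (f \<circ> z) M"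
  by (auto simp: step_curve_def)

text \<open>The step curve has variation exactly the length of the sequence, and composing it with
  \<open>f\<close> gives a step curve again. The loss \<open>\<delta>\<close> pays for a supremum
  that need not be attained. Length 0 is split off because \<open>LCJ\<close> only ranges over
  curves of positive variation.\<close>

lemma LCJ_path:
  fixes z :: "nat \<Rightarrow> 'a::metric_space"
  assumes "LCJ TYPE('a) \<ge> ennreal c" and "0 < c" and "0 < \<delta>" and "0 < M"
  obtains f :: "'a \<Rightarrow> real" where "1-lipschitz_on UNIV f"
    and "c * (\<Sum>k<M. dist (z k) (z (Suc k))) - \<delta> \<le> (\<Sum>k<M. \<bar>f (z k) - f (z (Suc k))\<bar>)"
proof (cases "(\<Sum>k<M. dist (z k) (z (Suc k))) = 0")
  case True
  show ?thesis
    by (rule that[of "\<lambda>_. 0"]) (use assms True in \<open>auto intro!: lipschitz_onI\<close>)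
next
  case False
  define S where "S = (\<Sum>k<M. dist (z k) (z (Suc k)))"
  have S: "S > 0"
    using False by (simp add: S_def sum_nonneg order.not_eq_order_implies_strict)
  let ?\<gamma> = "step_curve z M"
  have V: "total_variation ?\<gamma> = ennreal S"
    using total_variation_step_curve_le[of z M] total_variation_step_curve_ge[OF assms(4), of z]
    by (simp add: S_def)
  have "ennreal c \<le> lipschitz_variation ?\<gamma> / total_variation ?\<gamma>"
    using S V by (intro order_trans[OF assms(1)[unfolded LCJ_def] INF_lower]) (auto simp: BV_def)
  then have "ennreal c * ennreal S \<le> lipschitz_variation ?\<gamma> / ennreal S * ennreal S"
    unfolding V by (intro mult_right_mono) auto
  also have "\<dots> = lipschitz_variation ?\<gamma>"
    using S by (simp add: ennreal_divide_times)
  finally have "ennreal (c * S) \<le> lipschitz_variation ?\<gamma>"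
    using S assms(2) by (simp add: ennreal_mult)
  \<comment> \<open>This is strict even when \<open>c * S - \<delta>\<close> is negative: it is then
    truncated to 0, while \<open>c * S\<close> is positive.\<close>
  moreover have "ennreal (c * S - \<delta>) < ennreal (c * S)"
    using assms S by (intro ennreal_lessI) auto
  ultimately have "ennreal (c * S - \<delta>) < lipschitz_variation ?\<gamma>"
    by (rule less_le_trans[rotated])
  then obtain f :: "'a \<Rightarrow> real" where f: "1-lipschitz_on UNIV f"
      and less: "ennreal (c * S - \<delta>) < total_variation (f \<circ> ?\<gamma>)"
    unfolding lipschitz_variation_def by (auto simp: less_SUP_iff)
  note less
  also have "total_variation (f \<circ> ?\<gamma>) \<le> ennreal (\<Sum>k<M. \<bar>f (z k) - f (z (Suc k))\<bar>)"
    using total_variation_step_curve_le[of "f \<circ> z" M] by (simp add: comp_step_curve dist_real_def)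
  finally have "ennreal (c * S - \<delta>) < ennreal (\<Sum>k<M. \<bar>f (z k) - f (z (Suc k))\<bar>)" .
  then have "c * S - \<delta> \<le> (\<Sum>k<M. \<bar>f (z k) - f (z (Suc k))\<bar>)"
    using ennreal_leI linorder_not_less by (metis less_imp_le nle_le)
  then show ?thesis
    using that f by (simp add: S_def)
qed

text \<open>\<open>d\<close> is a parameter because the same path is measured both by
  \<open>dist\<close> and by the pseudometric that \<open>f\<close> induces.\<close>

fun path_length :: "('a \<Rightarrow> 'a \<Rightarrow> real) \<Rightarrow> 'a list \<Rightarrow> real" where
  "path_length d (a # b # xs) = d a b + path_length d (b # xs)"
| "path_length d xs = 0"

lemma path_length_eq_sum:
  "path_length d xs = (\<Sum>k<length xs - 1. d (xs ! k) (xs ! Suc k))"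
  by (induction d xs rule: path_length.induct) (auto simp: sum.lessThan_Suc_shift simp del: sum.lessThan_Suc)

lemma path_length_oscillation:
  assumes "\<And>a b. d a b = d b a"
  shows "path_length d (x # y # concat (replicate n [x, y]) @ zs)
    = real (2 * n) * d x y + path_length d (x # y # zs)"
proof (induction n)
  case (Suc n)
  then show ?case
    using assms[of x y] by (simp add: algebra_simps)
qed simp

text \<open>The edge between \<open>x\<close> and \<open>y\<close> is traversed
  \<open>2 * n + 1\<close> times. The return from \<open>y\<close> to \<open>x0\<close> is left to
  whatever list follows.\<close>

definition excursion :: "'a \<Rightarrow> 'a \<Rightarrow> 'a \<Rightarrow> nat \<Rightarrow> 'a list" where
  "excursion x0 x y n = x0 # x # y # concat (replicate n [x, y])"

lemma path_length_excursions:
  assumes sym: "\<And>a b. d a b = d b a"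
  shows "path_length d (concat (map (\<lambda>i. excursion x0 (X i) (Y i) (n i)) is) @ [x0])
    = (\<Sum>i\<leftarrow>is. d x0 (X i) + d (Y i) x0 + real (2 * n i + 1) * d (X i) (Y i))"
proof (induction "is")
  case (Cons i "is")
  \<comment> \<open>The remainder always starts at \<open>x0\<close>, which closes the i-th
    excursion by the edge from \<open>Y i\<close> to \<open>x0\<close>.\<close>
  have *: "\<exists>zs. concat (map (\<lambda>i. excursion x0 (X i) (Y i) (n i)) is) @ [x0] = x0 # zs"
    by (cases "is") (auto simp: excursion_def)
  then obtain zs where zs: "concat (map (\<lambda>i. excursion x0 (X i) (Y i) (n i)) is) @ [x0] = x0 # zs"
    by blast
  then show ?case
    using Cons path_length_oscillation[of d "X i" "Y i" "n i" "x0 # zs", OF sym]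
    by (simp add: excursion_def algebra_simps)
qed simp

section \<open>Finitely many pairs\<close>

text \<open>Running back and forth along the i-th pair about \<open>N * w i\<close> times makes the connecting
  pieces of the curve negligible for large \<open>N\<close>.\<close>

lemma LCJ_weighted:
  fixes X Y :: "nat \<Rightarrow> 'a::metric_space" and w :: "nat \<Rightarrow> real"
  assumes "LCJ TYPE('a) \<ge> ennreal c" and "0 < c" and "c < 1" and w: "\<And>i. i < m \<Longrightarrow> 0 \<le> w i"
    and "0 < \<epsilon>"
  obtains f where "f \<in> pointed_lipschitz x0"
    and "- \<epsilon> \<le> (\<Sum>i<m. w i * (\<bar>f (X i) - f (Y i)\<bar> - c * dist (X i) (Y i)))"
proof (cases "m = 0")
  case True
  show ?thesis
    by (rule that[of "\<lambda>_. 0"])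
      (use assms True in \<open>auto intro!: lipschitz_onI simp: pointed_lipschitz_def\<close>)
next
  case False
  define r where "r i = dist (X i) (Y i)" for i
  define D where "D i = dist x0 (X i) + dist (Y i) x0" for i
  \<comment> \<open>\<open>B\<close> collects all errors, independently of \<open>N\<close>: the
    connecting edges \<open>D i\<close>, the rounding of the multiplicities (\<open>r i\<close>),
    and the slack 1 used in \<open>LCJ_path\<close>. After division by \<open>2 * N\<close> it
    becomes \<open>\<epsilon>\<close>, which dictates \<open>N\<close>.\<close>
  define B where "B = (\<Sum>i<m. D i + r i) + 1"
  have "B > 0"
    unfolding B_def D_def r_def by (intro add_nonneg_pos sum_nonneg) auto
  define N where "N = B / (2 * \<epsilon>)"
  have "N > 0"
    using \<open>B > 0\<close> assms(5) by (simp add: N_def)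
  define n where "n i = nat \<lfloor>N * w i\<rfloor>" for i
  define L where "L = concat (map (\<lambda>i. excursion x0 (X i) (Y i) (n i)) [0..<m]) @ [x0]"
  have L: "path_length d L = (\<Sum>i<m. d x0 (X i) + d (Y i) x0 + real (2 * n i + 1) * d (X i) (Y i))"
    if "\<And>a b. d a b = d b a" for d
    unfolding L_def
    by (subst path_length_excursions[OF that])
      (auto simp: interv_sum_list_conv_sum_set_nat atLeast0LessThan)
  have len: "length L - 1 > 0"
    using False by (cases m) (auto simp: L_def excursion_def)
  obtain f where f: "1-lipschitz_on UNIV f"
    and fL: "c * path_length dist L - 1 \<le> path_length (\<lambda>a b. \<bar>f a - f b\<bar>) L"
    using LCJ_path[OF assms(1,2) zero_less_one len, of "\<lambda>k. L ! k"]
    unfolding path_length_eq_sum by blast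
  have lip: "\<bar>f a - f b\<bar> \<le> dist a b" for a b
    using lipschitz_onD[OF f, of a b] by (simp add: dist_real_def)
  define u where "u i = \<bar>f (X i) - f (Y i)\<bar> - c * r i" for i
  have u: "\<bar>u i\<bar> \<le> r i" for i
  proof -
    have "0 \<le> c * r i" "c * r i \<le> r i"
      using assms(2,3) by (auto simp: r_def mult_left_le_one_le)
    then show ?thesis
      using lip[of "X i" "Y i"] by (auto simp: u_def r_def)
  qed
  have summand: "\<bar>f x0 - f (X i)\<bar> + \<bar>f (Y i) - f x0\<bar> + real (2 * n i + 1) * \<bar>f (X i) - f (Y i)\<bar>
      - c * (dist x0 (X i) + dist (Y i) x0 + real (2 * n i + 1) * dist (X i) (Y i))
      \<le> (D i + r i) + 2 * N * (w i * u i)" if "i < m" for i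
  proof -
    have "0 \<le> N * w i"
      using \<open>N > 0\<close> w[OF that] by simp
    \<comment> \<open>From n <= N w < n + 1 it follows that the odd number 2n + 1 is within 1 of 2 N
      w.\<close>
    then have "\<bar>real (2 * n i + 1) - 2 * (N * w i)\<bar> \<le> 1"
      unfolding n_def by linarith
    then have "\<bar>real (2 * n i + 1) - 2 * (N * w i)\<bar> * \<bar>u i\<bar> \<le> 1 * r i"
      using u by (intro mult_mono) (auto simp: r_def)
    then have "(real (2 * n i + 1) - 2 * (N * w i)) * u i \<le> r i"
      by (metis abs_le_D1 abs_mult mult_1)
    moreover have "0 \<le> c * D i"
      using assms(2) by (simp add: D_def)
    moreover have "\<bar>f x0 - f (X i)\<bar> + \<bar>f (Y i) - f x0\<bar> \<le> D i"
      unfolding D_def by (intro add_mono lip)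
    ultimately show ?thesis
      by (simp add: u_def D_def r_def algebra_simps)
  qed
  have "- 1 \<le> path_length (\<lambda>a b. \<bar>f a - f b\<bar>) L - c * path_length dist L"
    using fL by simp
  also have "\<dots> = (\<Sum>i<m. \<bar>f x0 - f (X i)\<bar> + \<bar>f (Y i) - f x0\<bar>
      + real (2 * n i + 1) * \<bar>f (X i) - f (Y i)\<bar>
      - c * (dist x0 (X i) + dist (Y i) x0 + real (2 * n i + 1) * dist (X i) (Y i)))"
    by (subst (1 2) L) (simp_all add: abs_minus_commute dist_commute sum_subtractf sum_distrib_left)
  also have "\<dots> \<le> (\<Sum>i<m. (D i + r i) + 2 * N * (w i * u i))"
    by (intro sum_mono summand) auto
  also have "\<dots> = B - 1 + 2 * N * (\<Sum>i<m. w i * u i)"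
    by (simp add: B_def sum.distrib sum_distrib_left)
  finally have "- B \<le> 2 * N * (\<Sum>i<m. w i * u i)"
    by simp
  then have "B * (- \<epsilon>) \<le> B * (\<Sum>i<m. w i * u i)"
    using assms(5) by (simp add: N_def field_simps)
  then have "- \<epsilon> \<le> (\<Sum>i<m. w i * u i)"
    using \<open>B > 0\<close> by (simp only: mult_le_cancel_left_pos)
  moreover have "(\<lambda>x. f x - f x0) \<in> pointed_lipschitz x0"
    using lip by (auto simp: pointed_lipschitz_def dist_real_def intro!: lipschitz_onI)
  ultimately show ?thesis
    by (intro that[of "\<lambda>x. f x - f x0"]) (auto simp: u_def r_def)
qed

text \<open>The greedy strategy of Blackwell's approachability theorem: testing against the negative part
  of the accumulated vector keeps the squared norm of that negative part linear in \<open>k\<close>, so the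
  averages approach the positive orthant.\<close>

lemma approachability:
  fixes U :: "(nat \<Rightarrow> real) set"
  assumes bdd: "\<And>u i. u \<in> U \<Longrightarrow> i < m \<Longrightarrow> \<bar>u i\<bar> \<le> r i"
    and test: "\<And>w. (\<And>i. 0 \<le> w i) \<Longrightarrow> \<exists>u\<in>U. - 1 \<le> (\<Sum>i<m. w i * u i)"
  shows "\<exists>F. (\<forall>j<k. F j \<in> U) \<and>
    (\<Sum>i<m. (max 0 (- (\<Sum>j<k. F j i)))\<^sup>2) \<le> real k * ((\<Sum>i<m. (r i)\<^sup>2) + 2)"
proof (induction k)
  case (Suc k)
  then obtain F where F: "\<And>j. j < k \<Longrightarrow> F j \<in> U"
    and le: "(\<Sum>i<m. (max 0 (- (\<Sum>j<k. F j i)))\<^sup>2) \<le> real k * ((\<Sum>i<m. (r i)\<^sup>2) + 2)"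
    by blast
  define S where "S i = (\<Sum>j<k. F j i)" for i
  define w where "w i = max 0 (- S i)" for i
  obtain u where u: "u \<in> U" "- 1 \<le> (\<Sum>i<m. w i * u i)"
    using test[of w] by (auto simp: w_def)
  let ?F = "\<lambda>j. if j < k then F j else u"
  have sum: "(\<Sum>j<Suc k. ?F j i) = S i + u i" for i
    by (simp add: S_def)
  have "(max 0 (- (\<Sum>j<Suc k. ?F j i)))\<^sup>2 \<le> (w i)\<^sup>2 - 2 * (w i * u i) + (r i)\<^sup>2" if "i < m" for i
  proof -
    have "\<bar>max 0 (- (S i + u i))\<bar> \<le> \<bar>w i - u i\<bar>"
      by (auto simp: w_def)
    then have "(max 0 (- (S i + u i)))\<^sup>2 \<le> (w i - u i)\<^sup>2"
      by (subst (asm) abs_le_square_iff)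
    moreover have "(u i)\<^sup>2 \<le> (r i)\<^sup>2"
      using power_mono[OF bdd[OF u(1) that], of 2] by simp
    ultimately show ?thesis
      unfolding sum by (simp add: power2_diff)
  qed
  then have "(\<Sum>i<m. (max 0 (- (\<Sum>j<Suc k. ?F j i)))\<^sup>2)
      \<le> (\<Sum>i<m. (w i)\<^sup>2 - 2 * (w i * u i) + (r i)\<^sup>2)"
    by (intro sum_mono) auto
  also have "\<dots> = (\<Sum>i<m. (w i)\<^sup>2) - 2 * (\<Sum>i<m. w i * u i) + (\<Sum>i<m. (r i)\<^sup>2)"
    by (simp add: sum.distrib sum_subtractf sum_distrib_left)
  \<comment> \<open>The choice of \<open>u\<close> bounds the cross term by 2. Together with the
    squares of the \<open>r i\<close> this is exactly one increment of the bound.\<close>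
  also have "\<dots> \<le> real (Suc k) * ((\<Sum>i<m. (r i)\<^sup>2) + 2)"
    using le u(2) by (simp add: w_def S_def algebra_simps)
  finally show ?case
    using F u(1) by (intro exI[of _ ?F]) auto
qed simp

text \<open>Approachability is applied to the vectors \<open>v f\<close>, with
  \<open>LCJ_weighted\<close> as the test. After \<open>k\<close> rounds every accumulated deficit
  is at most sqrt(k R), so the average deficit is at most sqrt(R / k), hence at most
  \<open>\<epsilon>\<close> once k >= R / \<epsilon>^2.\<close>

lemma LCJ_finite_average:
  fixes X Y :: "nat \<Rightarrow> 'a::metric_space"
  assumes "LCJ TYPE('a) \<ge> ennreal c" and "0 < c" and "c < 1" and "0 < \<epsilon>"
  obtains k and f :: "nat \<Rightarrow> 'a \<Rightarrow> real"
  where "0 < k" and "\<And>j. j < k \<Longrightarrow> f j \<in> pointed_lipschitz x0"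
    and "\<And>i. i < m \<Longrightarrow> c * dist (X i) (Y i) - \<epsilon> \<le> (\<Sum>j<k. \<bar>f j (X i) - f j (Y i)\<bar>) / real k"
proof -
  define r where "r i = dist (X i) (Y i)" for i
  define v where "v f i = \<bar>f (X i) - f (Y i)\<bar> - c * r i" for f :: "'a \<Rightarrow> real" and i
  define R where "R = (\<Sum>i<m. (r i)\<^sup>2) + 2"
  have "R > 0"
    unfolding R_def by (intro add_nonneg_pos sum_nonneg) auto
  have bdd: "\<bar>u i\<bar> \<le> r i" if u: "u \<in> v ` pointed_lipschitz x0" for u i
  proof -
    obtain f where f: "1-lipschitz_on UNIV f" "u = v f"
      using u unfolding pointed_lipschitz_def by blast
    have "0 \<le> c * r i" "c * r i \<le> r i"
      using assms(2,3) by (auto simp: r_def mult_left_le_one_le)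
    then show ?thesis
      using lipschitz_onD[OF f(1), of "X i" "Y i"] by (auto simp: f(2) v_def r_def dist_real_def)
  qed
  have test: "\<exists>u\<in>v ` pointed_lipschitz x0. - 1 \<le> (\<Sum>i<m. w i * u i)" if "\<And>i. 0 \<le> w i" for w
    by (rule LCJ_weighted[OF assms(1-3), of m w 1 x0 X Y]) (use that in \<open>auto simp: v_def r_def\<close>)
  define k where "k = nat \<lceil>R / \<epsilon>\<^sup>2\<rceil>"
  have "R / \<epsilon>\<^sup>2 > 0"
    using \<open>R > 0\<close> assms(4) by simp
  then have k: "0 < k" "R / \<epsilon>\<^sup>2 \<le> real k"
    unfolding k_def by linarith+
  have "\<exists>F. (\<forall>j<k. F j \<in> v ` pointed_lipschitz x0) \<and>
      (\<Sum>i<m. (max 0 (- (\<Sum>j<k. F j i)))\<^sup>2) \<le> real k * R"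
    unfolding R_def by (rule approachability) (use bdd test in auto)
  then obtain F where F: "\<And>j. j < k \<Longrightarrow> F j \<in> v ` pointed_lipschitz x0"
    and le: "(\<Sum>i<m. (max 0 (- (\<Sum>j<k. F j i)))\<^sup>2) \<le> real k * R"
    by blast
  then obtain f where f: "\<And>j. j < k \<Longrightarrow> f j \<in> pointed_lipschitz x0" "\<And>j. j < k \<Longrightarrow> F j = v (f j)"
    unfolding image_iff by metis
  have "c * dist (X i) (Y i) - \<epsilon> \<le> (\<Sum>j<k. \<bar>f j (X i) - f j (Y i)\<bar>) / real k" if "i < m" for i
  proof -
    have "(max 0 (- (\<Sum>j<k. F j i)))\<^sup>2 \<le> (\<Sum>i<m. (max 0 (- (\<Sum>j<k. F j i)))\<^sup>2)"
      using that by (intro member_le_sum) auto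
    also have "\<dots> \<le> real k * (real k * \<epsilon>\<^sup>2)"
      using le k(2) assms(4)
      by (intro order_trans[OF le] mult_left_mono) (auto simp: field_simps)
    finally have "(max 0 (- (\<Sum>j<k. F j i)))\<^sup>2 \<le> (real k * \<epsilon>)\<^sup>2"
      by (simp add: power2_eq_square algebra_simps)
    then have "max 0 (- (\<Sum>j<k. F j i)) \<le> real k * \<epsilon>"
      by (rule power2_le_imp_le) (use assms(4) in simp)
    moreover have "(\<Sum>j<k. F j i) = (\<Sum>j<k. \<bar>f j (X i) - f j (Y i)\<bar>) - real k * (c * r i)"
      using f(2) by (simp add: v_def sum_subtractf)
    ultimately show ?thesis
      using k(1) by (simp add: r_def field_simps)
  qed
  then show ?thesis
    using that k(1) f(1) by blast
qed

section \<open>Coding points of the Hilbert cube by real numbers\<close>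

text \<open>Schoenberg's space-filling curve: \<open>bump (3 ^ k * t)\<close> is the k-th binary digit encoded by the
  point \<open>t\<close> of the Cantor set, and depends continuously on all real \<open>t\<close>.\<close>

definition bump :: "real \<Rightarrow> real" where
  "bump t = max 0 (min 1 (1 / 2 - cos (pi * t)))"

lemma bump_bounds: "0 \<le> bump t" "bump t \<le> 1"
  by (auto simp: bump_def)

lemma continuous_on_bump: "continuous_on A bump"
  unfolding bump_def by (intro continuous_intros)

lemma bump_periodic: "bump (t + 2 * real n) = bump t"
proof -
  have "cos (pi * (t + 2 * real n)) = cos (pi * t + 2 * real n * pi)"
    by (simp add: algebra_simps)
  also have "\<dots> = cos (pi * t)"
    by (simp only: cos_add cos_2npi sin_2npi)
  finally show ?thesis
    by (simp add: bump_def)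
qed

lemma bump_eq_0:
  assumes "0 \<le> t" "t \<le> 1 / 3"
  shows "bump t = 0"
proof -
  have "cos (pi / 3) \<le> cos (pi * t)"
    using assms by (intro cos_monotone_0_pi_le) (auto simp: field_simps)
  then show ?thesis
    by (simp add: bump_def cos_60)
qed

lemma bump_eq_1:
  assumes "2 / 3 \<le> t" "t \<le> 1"
  shows "bump t = 1"
proof -
  have "cos (pi / 3) \<le> cos (pi - pi * t)"
    using assms by (intro cos_monotone_0_pi_le) (auto simp: field_simps)
  then show ?thesis
    by (simp add: bump_def cos_60)
qed

text \<open>Take the Cantor point with ternary digits 2 b(k). Multiplying by 3^k splits off an even
  integer, which the period 2 of \<open>bump\<close> absorbs, and leaves the tail
  \<open>T k\<close>. This lies in [0, 1/3] or [2/3, 1] according to its leading digit, where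
  \<open>bump\<close> is constant.\<close>

lemma bump_digits:
  fixes b :: "nat \<Rightarrow> nat"
  assumes b: "\<And>k. b k \<le> 1"
  obtains t where "0 \<le> t" "t \<le> 1" "\<And>k. bump (3 ^ k * t) = real (b k)"
proof -
  define f where "f k j = 2 / 3 * real (b (k + j)) * (1 / 3) ^ j" for k j
  define T where "T k = suminf (f k)" for k
  have geo: "(\<lambda>j. 2 / 3 * (1 / 3) ^ j) sums (1 :: real)"
    using sums_mult[OF geometric_sums[of "1 / 3 :: real"], of "2 / 3"] by simp
  have f: "0 \<le> f k j" "f k j \<le> 2 / 3 * (1 / 3) ^ j" for k j
    using b[of "k + j"] by (auto simp: f_def)
  have summable: "summable (f k)" for k
    by (rule summable_comparison_test_ev[OF _ sums_summable[OF geo]]) (use f in auto)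
  have T: "0 \<le> T k" "T k \<le> 1" for k
    using suminf_nonneg[OF summable f(1)] suminf_le[OF f(2) summable sums_summable[OF geo]]
    by (auto simp only: T_def sums_unique[OF geo, symmetric])
  have step: "3 * T k = 2 * real (b k) + T (Suc k)" for k
  proof -
    have "f (Suc k) = (\<lambda>j. 3 * f k (Suc j))"
      by (auto simp: f_def)
    then have "T (Suc k) = 3 * (\<Sum>j. f k (Suc j))"
      unfolding T_def using summable[of k] by (simp add: suminf_mult summable_Suc_iff)
    also have "(\<Sum>j. f k (Suc j)) = T k - f k 0"
      unfolding T_def by (rule suminf_split_head[OF summable])
    finally show ?thesis
      by (simp add: f_def)
  qed
  have "\<exists>n. 3 ^ k * T 0 = T k + 2 * real n" for k
  proof (induction k)
    case (Suc k)
    then obtain n where "3 ^ k * T 0 = T k + 2 * real n"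
      by blast
    then have "3 ^ Suc k * T 0 = T (Suc k) + 2 * real (b k + 3 * n)"
      using step[of k] by simp
    then show ?case
      by blast
  qed (auto intro: exI[of _ 0])
  then have "bump (3 ^ k * T 0) = bump (T k)" for k
    by (metis bump_periodic)
  moreover have "bump (T k) = real (b k)" for k
  proof (cases "b k = 0")
    case True
    then show ?thesis
      using step[of k] T[of k] T[of "Suc k"] by (simp add: bump_eq_0)
  next
    case False
    then have "b k = 1"
      using b[of k] by simp
    then show ?thesis
      using step[of k] T[of k] T[of "Suc k"] by (simp add: bump_eq_1)
  qed
  ultimately show ?thesis
    using that[of "T 0"] T[of 0] by simp
qed

lemma binary_expansion:
  fixes x :: real
  assumes "0 \<le> x" "x \<le> 1"
  obtains b :: "nat \<Rightarrow> nat" where "\<And>k. b k \<le> 1" "(\<lambda>k. real (b k) / 2 ^ Suc k) sums x"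
proof -
  \<comment> \<open>The doubling map: \<open>y k\<close> is 2^k times what the first
    \<open>k\<close> digits leave of \<open>x\<close>, and it stays in [0, 1].\<close>
  define y where "y = rec_nat x (\<lambda>_ y. 2 * y - (if 1 / 2 \<le> y then 1 else 0))"
  define b :: "nat \<Rightarrow> nat" where "b k = (if 1 / 2 \<le> y k then 1 else 0)" for k
  have y_Suc: "y (Suc k) = 2 * y k - real (b k)" and y_0: "y 0 = x" for k
    by (simp_all add: y_def b_def)
  have y: "0 \<le> y k \<and> y k \<le> 1" for k
    by (induction k) (use assms in \<open>auto simp: y_0 y_Suc b_def\<close>)
  have "(\<Sum>k<n. real (b k) / 2 ^ Suc k) = x - y n * (1 / 2) ^ n" for n
    by (induction n) (simp_all add: y_0 y_Suc field_simps)
  moreover have "(\<lambda>n. y n * (1 / 2) ^ n) \<longlonglongrightarrow> 0"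
  proof (rule Lim_null_comparison)
    show "(\<lambda>n. (1 / 2) ^ n :: real) \<longlonglongrightarrow> 0"
      by (intro LIMSEQ_power_zero) auto
  qed (use y in \<open>auto simp: mult_left_le_one_le abs_mult\<close>)
  ultimately have "(\<lambda>k. real (b k) / 2 ^ Suc k) sums x"
    unfolding sums_def using tendsto_diff[OF tendsto_const, of _ 0 sequentially x] by simp
  then show ?thesis
    by (intro that[of b]) (auto simp: b_def)
qed

text \<open>\<open>prod_encode\<close> distributes the single digit sequence of \<open>t\<close>
  over countably many binary expansions, one per coordinate.\<close>

definition cube_coordinate :: "nat \<Rightarrow> real \<Rightarrow> real" where
  "cube_coordinate n t = (\<Sum>k. bump (3 ^ prod_encode (n, k) * t) / 2 ^ Suc k)"

lemma half_powers_sums: "(\<lambda>k. 1 / 2 ^ Suc k) sums (1 :: real)"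
  using power_half_series by (simp add: power_one_over)

lemma summable_cube_coordinate: "summable (\<lambda>k. bump (3 ^ prod_encode (n, k) * t) / 2 ^ Suc k)"
  by (rule summable_comparison_test_ev[OF _ sums_summable[OF half_powers_sums]])
    (auto simp: bump_bounds divide_right_mono)

lemma cube_coordinate_bounds: "0 \<le> cube_coordinate n t" "cube_coordinate n t \<le> 1"
proof -
  show "0 \<le> cube_coordinate n t"
    unfolding cube_coordinate_def
    by (intro suminf_nonneg summable_cube_coordinate) (auto simp: bump_bounds)
  have "cube_coordinate n t \<le> (\<Sum>k. 1 / 2 ^ Suc k)"
    unfolding cube_coordinate_def
    by (intro suminf_le summable_cube_coordinate sums_summable[OF half_powers_sums])
      (auto simp: bump_bounds divide_right_mono)
  then show "cube_coordinate n t \<le> 1"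
    by (simp only: sums_unique[OF half_powers_sums, symmetric])
qed

lemma continuous_on_cube_coordinate: "continuous_on A (cube_coordinate n)"
proof -
  have "uniform_limit A (\<lambda>N t. \<Sum>k<N. bump (3 ^ prod_encode (n, k) * t) / 2 ^ Suc k)
      (cube_coordinate n) sequentially"
    unfolding cube_coordinate_def
    by (rule Weierstrass_m_test[OF _ sums_summable[OF half_powers_sums]])
      (auto simp: bump_bounds divide_right_mono)
  then show ?thesis
    by (rule uniform_limit_theorem[rotated])
      (auto intro!: always_eventually continuous_intros
        continuous_on_compose2[OF continuous_on_bump[of UNIV]])
qed

lemma cube_coordinate_surj:
  assumes "\<And>n. 0 \<le> x n \<and> x n \<le> 1"
  obtains t where "0 \<le> t" "t \<le> 1" "\<And>n. cube_coordinate n t = x n"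
proof -
  have "\<exists>b :: nat \<Rightarrow> nat. (\<forall>k. b k \<le> 1) \<and> (\<lambda>k. real (b k) / 2 ^ Suc k) sums x n" for n
    using binary_expansion[of "x n"] assms[of n] by metis
  then obtain b :: "nat \<Rightarrow> nat \<Rightarrow> nat" where b: "\<And>n k. b n k \<le> 1"
    and sums: "\<And>n. (\<lambda>k. real (b n k) / 2 ^ Suc k) sums x n"
    by metis
  define b' where "b' k = (case prod_decode k of (n, k) \<Rightarrow> b n k)" for k
  have "b' k \<le> 1" for k
    using b by (simp add: b'_def split: prod.split)
  then obtain t where t: "0 \<le> t" "t \<le> 1" and digit: "\<And>k. bump (3 ^ k * t) = real (b' k)"
    using bump_digits by blast
  have "cube_coordinate n t = x n" for n
    unfolding cube_coordinate_def digit
    by (simp only: b'_def prod_encode_inverse prod.case sums_unique[OF sums, symmetric])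
  then show ?thesis
    using that t by blast
qed

section \<open>The limit measure\<close>

text \<open>\<open>M m\<close> is the law of \<open>\<tau> m j\<close> for a uniformly random index
  \<open>j\<close>, so repeated points keep their multiplicity. All these laws live on [0, 1], hence
  they are tight and a subsequence converges weakly.\<close>

lemma empirical_limit:
  fixes \<tau> :: "nat \<Rightarrow> nat \<Rightarrow> real"
  assumes k: "\<And>m. 0 < k m" and \<tau>: "\<And>m j. j < k m \<Longrightarrow> \<tau> m j \<in> {0..1}"
  obtains \<mu> and s :: "nat \<Rightarrow> nat" where "real_distribution \<mu>" "strict_mono s"
    and "\<And>\<phi> :: real \<Rightarrow> real. continuous_on UNIV \<phi> \<Longrightarrow> bounded (range \<phi>) \<Longrightarrow>
      (\<lambda>m. (\<Sum>j<k (s m). \<phi> (\<tau> (s m) j)) / real (k (s m))) \<longlonglongrightarrow> (\<integral>t. \<phi> t \<partial>\<mu>)"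
proof -
  define M where "M m = distr (measure_pmf (pmf_of_set {..<k m})) borel (\<tau> m)" for m
  have ne: "{..<k m} \<noteq> {}" for m
    using k[of m] by auto
  have M: "real_distribution (M m)" for m
    unfolding M_def by (rule prob_space.real_distribution_distr) (auto intro: prob_space_measure_pmf)
  \<comment> \<open>Tightness is tested on half-open intervals, so the left end lies below 0 to
    include the point 0.\<close>
  have "measure (M m) {-1<..1} = 1" for m
  proof -
    have "measure (M m) {-1<..1} = measure (measure_pmf (pmf_of_set {..<k m})) (\<tau> m -` {-1<..1})"
      unfolding M_def by (subst measure_distr) auto
    also have "\<dots> = card ({..<k m} \<inter> \<tau> m -` {-1<..1}) / card {..<k m}"
      using ne by (intro measure_pmf_of_set) auto
    also have "{..<k m} \<inter> \<tau> m -` {-1<..1} = {..<k m}"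
      using \<tau>[of _ m] by force
    finally show ?thesis
      using k[of m] by simp
  qed
  then have "tight M"
    unfolding tight_def using M
    by (intro conjI allI impI exI[of _ "-1 :: real"] exI[of _ "1 :: real"]) auto
  then obtain s \<mu> where s: "strict_mono s" and \<mu>: "real_distribution \<mu>"
    and conv: "weak_conv_m (M \<circ> id \<circ> s) \<mu>"
    using tight_imp_convergent_subsubsequence[of M id] by (auto simp: strict_mono_id)
  have int: "(\<integral>t. \<phi> t \<partial>M m) = (\<Sum>j<k m. \<phi> (\<tau> m j)) / real (k m)"
    if "continuous_on UNIV \<phi>" for m and \<phi> :: "real \<Rightarrow> real"
  proof -
    have "(\<integral>t. \<phi> t \<partial>M m) = (\<integral>j. \<phi> (\<tau> m j) \<partial>measure_pmf (pmf_of_set {..<k m}))"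
      unfolding M_def using borel_measurable_continuous_onI[OF that] by (subst integral_distr) auto
    then show ?thesis
      using ne by (simp add: integral_pmf_of_set)
  qed
  have "(\<lambda>m. (\<Sum>j<k (s m). \<phi> (\<tau> (s m) j)) / real (k (s m))) \<longlonglongrightarrow> (\<integral>t. \<phi> t \<partial>\<mu>)"
    if \<phi>: "continuous_on UNIV \<phi>" "bounded (range \<phi>)" for \<phi> :: "real \<Rightarrow> real"
  proof -
    obtain B where B: "\<And>t. norm (\<phi> t) \<le> B"
      using \<phi>(2) by (auto simp: bounded_iff)
    have "\<And>t. isCont \<phi> t"
      using \<phi>(1) by (simp add: continuous_on_eq_continuous_at)
    then show ?thesis
      using weak_conv_imp_integral_bdd_continuous_conv[OF _ \<mu> conv, of \<phi> B] B M
      by (simp add: int[OF \<phi>(1)])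
  qed
  then show ?thesis
    using that \<mu> s by blast
qed

section \<open>McShane's extension from a sequence of points\<close>

definition mcshane :: "(nat \<Rightarrow> 'a::metric_space) \<Rightarrow> (nat \<Rightarrow> real) \<Rightarrow> 'a \<Rightarrow> real" where
  "mcshane d h x = (INF n. h n + dist x (d n))"

context
  fixes d :: "nat \<Rightarrow> 'a::metric_space" and h :: "nat \<Rightarrow> real"
  assumes h: "\<bar>h p - h q\<bar> \<le> dist (d p) (d q)"
begin

text \<open>A real infimum is a lower bound only for sets bounded below; the Lipschitz condition on
  \<open>h\<close> supplies the bound \<open>h 0 - dist x (d 0)\<close>.\<close>

lemma mcshane_le: "mcshane d h x \<le> h n + dist x (d n)"
  unfolding mcshane_def
proof (rule cINF_lower)
  show "bdd_below (range (\<lambda>n. h n + dist x (d n)))"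
  proof (rule bdd_belowI2)
    fix n
    show "h 0 - dist x (d 0) \<le> h n + dist x (d n)"
      using h[of 0 n] dist_triangle[of "d 0" "d n" x] by (simp add: dist_commute)
  qed
qed simp

lemma mcshane_extends: "mcshane d h (d m) = h m"
proof (rule antisym)
  show "mcshane d h (d m) \<le> h m"
    using mcshane_le[of "d m" m] by simp
  show "h m \<le> mcshane d h (d m)"
    unfolding mcshane_def
  proof (rule cINF_greatest)
    fix n
    show "h m \<le> h n + dist (d m) (d n)"
      using h[of m n] by simp
  qed simp
qed

text \<open>An infimum of the 1-Lipschitz functions \<open>\<lambda>x. h n + dist x (d n)\<close> is
  again 1-Lipschitz.\<close>

lemma lipschitz_mcshane: "1-lipschitz_on UNIV (mcshane d h)"
proof (rule lipschitz_onI)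
  have le: "mcshane d h x - dist x y \<le> mcshane d h y" for x y
    unfolding mcshane_def[of d h y]
  proof (rule cINF_greatest)
    fix n
    show "mcshane d h x - dist x y \<le> h n + dist y (d n)"
      using mcshane_le[of x n] dist_triangle[of x "d n" y] by simp
  qed simp
  show "dist (mcshane d h x) (mcshane d h y) \<le> 1 * dist x y" for x y
    using le[of x y] le[of y x] by (simp add: dist_real_def dist_commute)
qed simp

end

section \<open>Codes of Lipschitz functions and the limit measure on codes\<close>

lemma pointed_lipschitzD:
  assumes "f \<in> pointed_lipschitz x0"
  shows "f x0 = 0" "\<bar>f x - f y\<bar> \<le> dist x y"
  using assms lipschitz_onD[of 1 UNIV f x y] by (auto simp: pointed_lipschitz_def dist_real_def)

text \<open>A 1-Lipschitz function vanishing at \<open>d 0\<close> is bounded at \<open>d n\<close>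
  by \<open>dist (d 0) (d n)\<close>; the coordinate in [0, 1] is rescaled to this symmetric
  interval. Distinct coordinates are not tied together, so a general \<open>t\<close> need not code
  a Lipschitz function.\<close>

definition lipschitz_code :: "(nat \<Rightarrow> 'a::metric_space) \<Rightarrow> nat \<Rightarrow> real \<Rightarrow> real" where
  "lipschitz_code d n t = dist (d 0) (d n) * (2 * cube_coordinate n t - 1)"

lemma lipschitz_code_surj:
  fixes d :: "nat \<Rightarrow> 'a::metric_space"
  assumes "f \<in> pointed_lipschitz (d 0)"
  obtains t where "t \<in> {0..1}" "\<And>n. lipschitz_code d n t = f (d n)"
proof -
  define a where "a n = dist (d 0) (d n)" for n
  have f: "\<bar>f (d n)\<bar> \<le> a n" for n
    using pointed_lipschitzD(2)[OF assms, of "d 0" "d n"] pointed_lipschitzD(1)[OF assms]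
    by (simp add: a_def)
  \<comment> \<open>If \<open>a n = 0\<close>, the target interval is the single point 0 and any
    coordinate would do.\<close>
  define x where "x n = (if a n = 0 then 0 else (f (d n) / a n + 1) / 2)" for n
  have "0 \<le> x n \<and> x n \<le> 1" for n
  proof (cases "a n = 0")
    case False
    then have "a n > 0"
      by (simp add: a_def)
    then show ?thesis
      using f[of n] by (auto simp: x_def field_simps)
  qed (simp add: x_def)
  then obtain t where t: "0 \<le> t" "t \<le> 1" "\<And>n. cube_coordinate n t = x n"
    using cube_coordinate_surj by blast
  have "lipschitz_code d n t = a n * (2 * x n - 1)" for n
    by (simp add: lipschitz_code_def a_def t(3))
  moreover have "a n * (2 * x n - 1) = f (d n)" for n
    using f[of n] by (auto simp: x_def field_simps)
  ultimately show ?thesis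
    using that[of t] t by simp
qed

lemma continuous_on_lipschitz_code: "continuous_on A (lipschitz_code d n)"
  unfolding lipschitz_code_def by (intro continuous_intros continuous_on_cube_coordinate)

lemma lipschitz_code_bound: "\<bar>lipschitz_code d n t\<bar> \<le> dist (d 0) (d n)"
proof -
  have "\<bar>2 * cube_coordinate n t - 1\<bar> \<le> 1"
    using cube_coordinate_bounds[of n t] by linarith
  then show ?thesis
    by (simp add: lipschitz_code_def abs_mult mult_left_le)
qed

text \<open>Stage \<open>m\<close> treats the first \<open>m\<close> pairs with error 1/(m+1), so
  every pair is eventually included. Both conclusions are expressed by integrals of bounded
  continuous functions of the code, and therefore survive the weak limit.\<close>

lemma LCJ_coded_measure:
  fixes d :: "nat \<Rightarrow> 'a::metric_space"
  assumes "LCJ TYPE('a) \<ge> ennreal c" and "0 < c" and "c < 1"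
  obtains \<mu> where "real_distribution \<mu>"
    and "\<And>p q. AE t in \<mu>. \<bar>lipschitz_code d p t - lipschitz_code d q t\<bar> \<le> dist (d p) (d q)"
    and "\<And>p q. c * dist (d p) (d q) \<le> (\<integral>t. \<bar>lipschitz_code d p t - lipschitz_code d q t\<bar> \<partial>\<mu>)"
proof -
  let ?G = "lipschitz_code d" and ?K = "pointed_lipschitz (d 0)"
  define X where "X i = d (fst (prod_decode i))" for i
  define Y where "Y i = d (snd (prod_decode i))" for i
  define P where "P m k f \<longleftrightarrow> 0 < k \<and> (\<forall>j<k. f j \<in> ?K) \<and> (\<forall>i<m. c * dist (X i) (Y i) - 1 / Suc m
      \<le> (\<Sum>j<k. \<bar>f j (X i) - f j (Y i)\<bar>) / real k)" for m k and f :: "nat \<Rightarrow> 'a \<Rightarrow> real"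
  have "\<exists>k f. P m k f" for m
  proof -
    have "0 < 1 / real (Suc m)"
      by simp
    then show ?thesis
      unfolding P_def by (rule LCJ_finite_average[OF assms, of _ "d 0" m X Y]) blast
  qed
  then obtain k f where P: "\<And>m. P m (k m) (f m)"
    by metis
  have k: "\<And>m. 0 < k m" and f: "\<And>m j. j < k m \<Longrightarrow> f m j \<in> ?K"
    and avg: "\<And>m i. i < m \<Longrightarrow> c * dist (X i) (Y i) - 1 / Suc m
      \<le> (\<Sum>j<k m. \<bar>f m j (X i) - f m j (Y i)\<bar>) / real (k m)"
    using P unfolding P_def by blast+
  define Q where "Q m j t \<longleftrightarrow> (j < k m \<longrightarrow> t \<in> {0..1} \<and> (\<forall>n. ?G n t = f m j (d n)))" for m j t
  have "\<exists>t. Q m j t" for m j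
    unfolding Q_def by (cases "j < k m") (use lipschitz_code_surj[where d = d, OF f] in blast)+
  then obtain \<tau> where Q: "\<And>m j. Q m j (\<tau> m j)"
    by metis
  have \<tau>: "\<And>m j. j < k m \<Longrightarrow> \<tau> m j \<in> {0..1}"
    and code: "\<And>m j n. j < k m \<Longrightarrow> ?G n (\<tau> m j) = f m j (d n)"
    using Q unfolding Q_def by blast+
  obtain \<mu> and s :: "nat \<Rightarrow> nat" where \<mu>: "real_distribution \<mu>" and s: "strict_mono s"
    and lim: "\<And>\<phi> :: real \<Rightarrow> real. continuous_on UNIV \<phi> \<Longrightarrow> bounded (range \<phi>) \<Longrightarrow>
      (\<lambda>m. (\<Sum>j<k (s m). \<phi> (\<tau> (s m) j)) / real (k (s m))) \<longlonglongrightarrow> (\<integral>t. \<phi> t \<partial>\<mu>)"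
    using empirical_limit[of k \<tau>, OF k \<tau>] by blast
  interpret real_distribution \<mu>
    by (rule \<mu>)
  show ?thesis
  proof (rule that[OF \<mu>])
    fix p q
    \<comment> \<open>A bounded, continuous, nonnegative function that vanishes exactly where the
      Lipschitz inequality for this pair holds. It is 0 at every \<open>\<tau> m j\<close>, so its
      limit integral is 0.\<close>
    let ?\<psi> = "\<lambda>t. min 1 (max 0 (\<bar>?G p t - ?G q t\<bar> - dist (d p) (d q)))"
    have cont: "continuous_on UNIV ?\<psi>"
      by (intro continuous_intros continuous_on_lipschitz_code)
    have bdd: "\<bar>?\<psi> t\<bar> \<le> 1" for t
      by auto
    have "(\<Sum>j<k m. ?\<psi> (\<tau> m j)) = 0" for m
    proof (rule sum.neutral, clarify)
      fix j
      assume "j < k m"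
      then show "?\<psi> (\<tau> m j) = 0"
        using pointed_lipschitzD(2)[OF f, of j m "d p" "d q"] by (simp add: code)
    qed
    moreover have "bounded (range ?\<psi>)"
      by (intro boundedI[where B = 1]) auto
    ultimately have "(\<integral>t. ?\<psi> t \<partial>\<mu>) = 0"
      using lim[OF cont] by (simp add: LIMSEQ_const_iff)
    moreover have "integrable \<mu> ?\<psi>"
      using bdd borel_measurable_continuous_onI[OF cont] by (intro integrable_const_bound[of _ 1]) auto
    ultimately have "AE t in \<mu>. ?\<psi> t = 0"
      by (subst (asm) integral_nonneg_eq_0_iff_AE) auto
    then show "AE t in \<mu>. \<bar>?G p t - ?G q t\<bar> \<le> dist (d p) (d q)"
      by eventually_elim (auto simp: min_def max_def split: if_splits)
  next
    fix p q
    let ?\<phi> = "\<lambda>t. \<bar>?G p t - ?G q t\<bar>"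
    define i where "i = prod_encode (p, q)"
    have "\<bar>?\<phi> t\<bar> \<le> dist (d 0) (d p) + dist (d 0) (d q)" for t
      using lipschitz_code_bound[of d p t] lipschitz_code_bound[of d q t] by linarith
    then have "bounded (range ?\<phi>)"
      by (auto simp: bounded_iff)
    moreover have "continuous_on UNIV ?\<phi>"
      by (intro continuous_intros continuous_on_lipschitz_code)
    ultimately have "(\<lambda>m. (\<Sum>j<k (s m). ?\<phi> (\<tau> (s m) j)) / real (k (s m))) \<longlonglongrightarrow> (\<integral>t. ?\<phi> t \<partial>\<mu>)"
      by (intro lim)
    moreover have "(\<lambda>m. 1 / Suc (s m)) \<longlonglongrightarrow> (0 :: real)"
      using LIMSEQ_subseq_LIMSEQ[OF lim_1_over_n[THEN LIMSEQ_Suc] s] by (simp add: o_def)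
    ultimately have "(\<lambda>m. (\<Sum>j<k (s m). ?\<phi> (\<tau> (s m) j)) / real (k (s m)) + 1 / Suc (s m))
        \<longlonglongrightarrow> (\<integral>t. ?\<phi> t \<partial>\<mu>) + 0"
      by (rule tendsto_add)
    moreover have "\<forall>\<^sub>F m in sequentially. c * dist (d p) (d q)
        \<le> (\<Sum>j<k (s m). ?\<phi> (\<tau> (s m) j)) / real (k (s m)) + 1 / Suc (s m)"
    proof (rule eventually_sequentiallyI[of "Suc i"])
      fix m
      assume "Suc i \<le> m"
      then have "i < s m"
        using seq_suble[OF s, of m] by simp
      moreover have "(\<Sum>j<k (s m). ?\<phi> (\<tau> (s m) j)) = (\<Sum>j<k (s m). \<bar>f (s m) j (X i) - f (s m) j (Y i)\<bar>)"
        by (intro sum.cong) (auto simp: code X_def Y_def i_def)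
      ultimately show "c * dist (d p) (d q)
        \<le> (\<Sum>j<k (s m). ?\<phi> (\<tau> (s m) j)) / real (k (s m)) + 1 / Suc (s m)"
        using avg[of i "s m"] by (simp add: X_def Y_def i_def)
    qed
    ultimately show "c * dist (d p) (d q) \<le> (\<integral>t. ?\<phi> t \<partial>\<mu>)"
      by (intro tendsto_lowerbound[of _ "(\<integral>t. ?\<phi> t \<partial>\<mu>)" sequentially]) auto
  qed
qed

section \<open>From a dense sequence to the whole space\<close>

lemma separable_sequence:
  fixes x0 :: "'a::metric_space"
  assumes "separable_space (euclidean :: 'a topology)"
  obtains d :: "nat \<Rightarrow> 'a" where "d 0 = x0" "\<And>x \<epsilon>. 0 < \<epsilon> \<Longrightarrow> \<exists>n. dist x (d n) < \<epsilon>"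
proof -
  obtain D :: "'a set" where D: "countable D" "closure D = UNIV"
    using assms by (auto simp: separable_space_def)
  \<comment> \<open>Index 0 is reserved for \<open>x0\<close>, since the codes are anchored at
    \<open>d 0\<close>.\<close>
  define d where "d = case_nat x0 (from_nat_into (insert x0 D))"
  have "\<exists>n. dist x (d n) < \<epsilon>" if \<epsilon>: "0 < \<epsilon>" for x \<epsilon>
  proof -
    have "x \<in> closure D"
      using D(2) by simp
    then obtain y where y: "y \<in> D" "dist y x < \<epsilon>"
      using \<epsilon> unfolding closure_approachable by blast
    then obtain n where "from_nat_into (insert x0 D) n = y"
      using from_nat_into_surj[of "insert x0 D" y] D(1) by auto
    then have "d (Suc n) = y"
      by (simp add: d_def)
    then show ?thesis
      using y(2) by (metis dist_commute)
  qed
  then show ?thesis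
    using that[of d] by (simp add: d_def)
qed

theorem theorem2p1:
  fixes x0 :: "'a::metric_space" and c :: real
  assumes "separable_space (euclidean :: 'a topology)"
    and "0 < c" and "c < 1"
    and "LCJ TYPE('a) \<ge> ennreal c"
  shows "\<exists>\<nu>. borel_probability_on (pointed_lipschitz x0) \<nu> \<and>
           (\<forall>x y. (\<integral>f. \<bar>f x - f y\<bar> \<partial>\<nu>) \<ge> c * dist x y)"
proof -
  obtain d :: "nat \<Rightarrow> 'a" where d0: "d 0 = x0" and dense: "\<And>x \<epsilon>. 0 < \<epsilon> \<Longrightarrow> \<exists>n. dist x (d n) < \<epsilon>"
    using separable_sequence[OF assms(1), of x0] by blast
  let ?G = "lipschitz_code d" and ?K = "pointed_lipschitz x0"
  obtain \<mu> where \<mu>: "real_distribution \<mu>"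
    and AE_G: "\<And>p q. AE t in \<mu>. \<bar>?G p t - ?G q t\<bar> \<le> dist (d p) (d q)"
    and int_G: "\<And>p q. c * dist (d p) (d q) \<le> (\<integral>t. \<bar>?G p t - ?G q t\<bar> \<partial>\<mu>)"
    using LCJ_coded_measure[OF assms(4,2,3), of d] by blast
  interpret real_distribution \<mu>
    by (rule \<mu>)
  \<comment> \<open>The codes that do come from a 1-Lipschitz function on the sequence.
    \<open>T\<close> is closed by continuity, and has full measure since there are only countably
    many pairs.\<close>
  define T where "T = {t. \<forall>p q. \<bar>?G p t - ?G q t\<bar> \<le> dist (d p) (d q)}"
  have "closed T"
    unfolding T_def
    by (intro closed_Collect_all closed_Collect_le continuous_intros continuous_on_lipschitz_code)
  have AE_T: "AE t in \<mu>. t \<in> T"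
    using AE_G by (simp add: T_def AE_all_countable)
  define \<Phi> where "\<Phi> t = mcshane d (\<lambda>n. ?G n t)" for t
  have \<Phi>_ext: "\<Phi> t (d n) = ?G n t" and \<Phi>_lip: "1-lipschitz_on UNIV (\<Phi> t)" if "t \<in> T" for t n
    using that mcshane_extends[of "\<lambda>n. ?G n t" d] lipschitz_mcshane[of "\<lambda>n. ?G n t" d]
    by (auto simp: \<Phi>_def T_def)
  have \<Phi>_K: "\<Phi> t \<in> ?K" if "t \<in> T" for t
    using \<Phi>_ext[OF that, of 0] \<Phi>_lip[OF that]
    by (simp add: pointed_lipschitz_def d0 lipschitz_code_def)
  \<comment> \<open>An e/3 argument: move from \<open>x\<close> to a nearby \<open>d n\<close> under
    \<open>\<Phi> s\<close>, use continuity of the n-th code there, and move back under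
    \<open>\<Phi> t\<close>.\<close>
  have \<Phi>_cont: "continuous_on T (\<lambda>t. \<Phi> t x)" for x
    unfolding continuous_on_iff
  proof (intro ballI allI impI)
    fix t and e :: real
    assume t: "t \<in> T" and "0 < e"
    then obtain n where n: "dist x (d n) < e / 3"
      using dense[of "e / 3" x] by auto
    obtain \<delta> where "\<delta> > 0" and \<delta>: "\<And>s. dist s t < \<delta> \<Longrightarrow> dist (?G n s) (?G n t) < e / 3"
      using continuous_on_lipschitz_code[of UNIV d n] \<open>0 < e\<close> unfolding continuous_on_iff
      by (metis UNIV_I zero_less_divide_iff zero_less_numeral)
    have "dist (\<Phi> s x) (\<Phi> t x) < e" if s: "s \<in> T" "dist s t < \<delta>" for s
      using \<delta>[OF s(2)] n pointed_lipschitzD(2)[OF \<Phi>_K[OF s(1)], of x "d n"]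
        pointed_lipschitzD(2)[OF \<Phi>_K[OF t], of x "d n"]
      unfolding \<Phi>_ext[OF s(1)] \<Phi>_ext[OF t] dist_real_def by linarith
    then show "\<exists>\<delta>>0. \<forall>s\<in>T. dist s t < \<delta> \<longrightarrow> dist (\<Phi> s x) (\<Phi> t x) < e"
      using \<open>\<delta> > 0\<close> by blast
  qed
  \<comment> \<open>Off the null set the zero function serves as a value in
    \<open>pointed_lipschitz x0\<close>, so that \<open>\<Psi>\<close> maps all reals there and
    stays Borel.\<close>
  define \<Psi> where "\<Psi> t = (if t \<in> T then \<Phi> t else (\<lambda>_. 0))" for t
  have \<Psi>_K: "\<Psi> t \<in> ?K" for t
    using \<Phi>_K by (auto simp: \<Psi>_def pointed_lipschitz_def intro!: lipschitz_onI)
  have "\<Psi> \<in> borel_measurable borel"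
    unfolding \<Psi>_def using \<open>closed T\<close>
    by (intro borel_measurable_continuous_on_if continuous_on_coordinatewise_then_product \<Phi>_cont) auto
  then have \<Psi>_meas: "\<Psi> \<in> measurable \<mu> (restrict_space borel ?K)"
    using \<Psi>_K by (intro measurable_restrict_space2) (auto simp: measurable_cong_sets[OF events_eq_borel refl])
  define \<nu> where "\<nu> = distr \<mu> (restrict_space borel ?K) \<Psi>"
  have "borel_probability_on ?K \<nu>"
    unfolding borel_probability_on_def \<nu>_def using \<Psi>_meas by (simp add: prob_space_distr)
  moreover have "c * dist x y \<le> (\<integral>f. \<bar>f x - f y\<bar> \<partial>\<nu>)" for x y
  proof -
    have eval: "(\<lambda>f. \<bar>f x - f y\<bar>) \<in> borel_measurable (restrict_space borel ?K)"
      by (intro measurable_restrict_space1 borel_measurable_continuous_onI continuous_intros) auto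
    have int_\<Psi>: "integrable \<mu> (\<lambda>t. \<bar>\<Psi> t x - \<Psi> t y\<bar>)"
      using measurable_compose[OF \<Psi>_meas eval] pointed_lipschitzD(2)[OF \<Psi>_K, of _ x y]
      by (intro integrable_const_bound[of _ "dist x y"]) auto
    have "c * dist x y \<le> (\<integral>t. \<bar>\<Psi> t x - \<Psi> t y\<bar> \<partial>\<mu>)"
    proof (rule field_le_epsilon)
      fix e :: real
      assume "0 < e"
      \<comment> \<open>Replacing \<open>x\<close>, \<open>y\<close> by points within e/4 costs at
        most e/2 in the distance, even before the factor \<open>c < 1\<close>, and at most e/2 in
        the integrand because each \<open>\<Psi> t\<close> is 1-Lipschitz.\<close>
      then obtain p q where p: "dist x (d p) < e / 4" and q: "dist y (d q) < e / 4"
        using dense[of "e / 4"] by (metis zero_less_divide_iff zero_less_numeral)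
      have "dist x y \<le> dist (d p) (d q) + e / 2"
        using p q dist_triangle[of x y "d p"] dist_triangle[of "d p" y "d q"]
        by (simp add: dist_commute)
      then have "c * dist x y \<le> c * (dist (d p) (d q) + e / 2)"
        using assms(2) by simp
      also have "\<dots> \<le> c * dist (d p) (d q) + e / 2"
        using assms(2,3) \<open>0 < e\<close> by (simp add: distrib_left)
      also have "c * dist (d p) (d q) \<le> (\<integral>t. \<bar>?G p t - ?G q t\<bar> \<partial>\<mu>)"
        by (rule int_G)
      also have "\<dots> \<le> (\<integral>t. \<bar>\<Psi> t x - \<Psi> t y\<bar> + e / 2 \<partial>\<mu>)"
      proof (rule integral_mono_AE)
        have "continuous_on UNIV (\<lambda>t. \<bar>?G p t - ?G q t\<bar>)"
          by (intro continuous_intros continuous_on_lipschitz_code)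
        then have "(\<lambda>t. \<bar>?G p t - ?G q t\<bar>) \<in> borel_measurable \<mu>"
          using borel_measurable_continuous_onI by (simp add: measurable_cong_sets[OF events_eq_borel refl])
        then show "integrable \<mu> (\<lambda>t. \<bar>?G p t - ?G q t\<bar>)"
          using AE_G[of p q] by (intro integrable_const_bound[of _ "dist (d p) (d q)"]) auto
        show "integrable \<mu> (\<lambda>t. \<bar>\<Psi> t x - \<Psi> t y\<bar> + e / 2)"
          using int_\<Psi> by simp
        show "AE t in \<mu>. \<bar>?G p t - ?G q t\<bar> \<le> \<bar>\<Psi> t x - \<Psi> t y\<bar> + e / 2"
          using AE_T
        proof eventually_elim
          case (elim t)
          then have "?G p t = \<Psi> t (d p)" "?G q t = \<Psi> t (d q)"
            by (simp_all add: \<Psi>_def \<Phi>_ext)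
          then show ?case
            using pointed_lipschitzD(2)[OF \<Psi>_K, of t x "d p"]
              pointed_lipschitzD(2)[OF \<Psi>_K, of t y "d q"] p q by linarith
        qed
      qed
      also have "\<dots> = (\<integral>t. \<bar>\<Psi> t x - \<Psi> t y\<bar> \<partial>\<mu>) + e / 2"
        using int_\<Psi> prob_space by simp
      finally show "c * dist x y \<le> (\<integral>t. \<bar>\<Psi> t x - \<Psi> t y\<bar> \<partial>\<mu>) + e"
        by simp
    qed
    also have "\<dots> = (\<integral>f. \<bar>f x - f y\<bar> \<partial>\<nu>)"
      unfolding \<nu>_def by (rule integral_distr[OF \<Psi>_meas eval, symmetric])
    finally show ?thesis .
  qed
  ultimately show ?thesis
    by blast
qed

end
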